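(* Let $f:\mathbb{R}^d\to\mathbb{R}$ be $L$-smooth (possibly nonconvex), let $h:\mathbb{R}^d\to\mathbb{R}\cup\{+\infty\}$ be convex, proper and lower semicontinuous, and let $F=f+h$ be bounded from below with $F^*:=\inf_{x\in\mathbb{R}^d}F(x)$. Let $\gamma,\eta>0$ be arbitrary, let $x_1\in\mathrm{dom}(h)$, and let $\{x_k\}_{k\ge1}$ be the iterates generated by the full-gradient adaptive proximal gradient method $$x_{k+1}=\operatorname*{arg\,min}_{x\in\mathbb{R}^d}\Big\{\langle \nabla f(x_k),x\rangle+\frac{S_k}{2\eta}\|x-x_k\|^2+h(x)\Big\},\qquad S_1=\gamma,\quad S_{k+1}^2=S_k^2\Big(1+\frac{\|x_{k+1}-x_k\|^2}{\eta^2}\Big),\quad k\ge1.$$ Suppose there is a constant $D>0$ such that $\|x_{k+1}-x_k\|\le D$ for all $k\ge1$ (and, if $F$ is convex, also $\|x_k-x^*\|\le D$ for all $k\ge1$, where $x^*$ is a global minimizer of $F$, assumed to exist in that case). Let $\eta_k:=\eta/S_k$, let $$\mathcal{G}_k:=\frac{1}{\eta_k}\big(x_k-\mathrm{prox}_{\eta_k h}(x_k-\eta_k\nabla f(x_k))\big)$$ be the gradient mapping at $x_k$, and define $$M:=F(x_1)-F^*+\Big[L(\eta^2+D^2)\log\frac{L\eta}{2\gamma}+\frac{LD^2}{2}\Big]_+ .$$ Then for every $t\ge1$, $$\frac1t\sum_{k=1}^t\|\mathcal{G}_k\|^2\le\frac1t\Big[\Big(\frac{M}{\eta}+L\eta+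\frac{LD}{2}\Big)^2+\frac{2M\gamma}{\eta}\Big].$$
   Context: $\|\cdot\|$ is the Euclidean norm, $\log$ is the natural logarithm, and $[a]_+:=\max\{0,a\}$. For $L>0$, $f$ is $L$-smooth if it is continuously differentiable and $\|\nabla f(y)-\nabla f(x)\|\le L\|y-x\|$ for all $x,y$. $\mathrm{dom}(h):=\{x:h(x)<+\infty\}$. The proximal operator is $\mathrm{prox}_h(x):=\operatorname*{arg\,min}_{z}\{h(z)+\frac12\|z-x\|^2\}$. $S_k>0$. *)

theory Defs
  imports "HOL-Analysis.Analysis"
begin

definition gradient :: "('a::real_inner \<Rightarrow> real) \<Rightarrow> 'a \<Rightarrow> 'a" where
  "gradient f x = (THE g. GDERIV f x :> g)"

definition smooth_with :: "real \<Rightarrow> ('a::euclidean_space \<Rightarrow> real) \<Rightarrow> bool" where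
  "smooth_with L f \<longleftrightarrow>
     (\<forall>x. f differentiable (at x)) \<and> continuous_on UNIV (gradient f) \<and>
     (\<forall>x y. norm (gradient f y - gradient f x) \<le> L * norm (y - x))"

text \<open>
  Functions into the reals extended by plus infinity are represented as \<open>ereal\<close>-valued
  functions that never take the value \<open>-\<infinity>\<close>, which is part of \<open>ereal_proper\<close>. For such
  functions the right-hand side in \<open>ereal_convex\<close> contains no \<open>\<infinity> - \<infinity>\<close>, and as
  \<open>0 * \<infinity> = 0\<close> the inequality is trivial at the endpoints \<open>u = 0\<close> and \<open>u = 1\<close>.
\<close>

definition effective_domain :: "('a \<Rightarrow> ereal) \<Rightarrow> 'a set" where
  "effective_domain h = {x. h x < \<infinity>}"

definition ereal_proper :: "('a \<Rightarrow> ereal) \<Rightarrow> bool" where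
  "ereal_proper h \<longleftrightarrow> (\<forall>x. h x \<noteq> -\<infinity>) \<and> effective_domain h \<noteq> {}"

definition ereal_convex :: "('a::real_vector \<Rightarrow> ereal) \<Rightarrow> bool" where
  "ereal_convex h \<longleftrightarrow>
     (\<forall>x y u. 0 \<le> u \<and> u \<le> 1 \<longrightarrow>
        h ((1 - u) *\<^sub>R x + u *\<^sub>R y) \<le> ereal (1 - u) * h x + ereal u * h y)"

definition ereal_lsc :: "('a::topological_space \<Rightarrow> ereal) \<Rightarrow> bool" where
  "ereal_lsc h \<longleftrightarrow> (\<forall>x. h x \<le> Liminf (at x) h)"

definition prox :: "('a::real_inner \<Rightarrow> ereal) \<Rightarrow> 'a \<Rightarrow> 'a" where
  "prox h x = arg_min (\<lambda>z. h z + ereal (1 / 2 * (norm (z - x))\<^sup>2)) (\<lambda>_. True)"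

definition gradient_mapping ::
    "('a::real_inner \<Rightarrow> real) \<Rightarrow> ('a \<Rightarrow> ereal) \<Rightarrow> real \<Rightarrow> 'a \<Rightarrow> 'a" where
  "gradient_mapping f h \<alpha> x =
     (1 / \<alpha>) *\<^sub>R (x - prox (\<lambda>z. ereal \<alpha> * h z) (x - \<alpha> *\<^sub>R gradient f x))"

end

theory Submission
  imports Defs
begin

text \<open>
  Since \<open>x (k + 1)\<close> is the proximal step from \<open>x k\<close>, the squared gradient mappings telescope:
  their sum is \<open>(S (t + 1))\<^sup>2 - \<gamma>\<^sup>2\<close>, so it suffices to bound \<open>S\<close>. Smoothness of \<open>f\<close> and strong
  convexity of the proximal model give the descent inequality
  \<open>F (x (k + 1)) \<le> F (x k) + (L / 2 - S k / \<eta>) * (norm (x (k + 1) - x k))\<^sup>2\<close>.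
  As long as \<open>S k \<le> L * \<eta> / 2\<close> the function value may grow, but the squared steps are
  bounded by increments of \<open>ln (S k)\<close>, which yields \<open>F (x k) - F* \<le> M\<close> throughout. As soon
  as \<open>S k \<ge> L * \<eta>\<close> the potential \<open>S k + (F (x k) - F* ) / \<eta>\<close> is nonincreasing, and a look at
  the single step crossing this threshold gives the constant in the bound.
\<close>

section \<open>Gradients and the quadratic upper bound for smooth functions\<close>

text \<open>\<open>gradient\<close> is a definite description, so existence and uniqueness are both
  needed. The values of the derivative on \<open>Basis\<close> assemble the representing vector, and
  inner products with all vectors determine it.\<close>

lemma GDERIV_gradient:
  fixes f :: "'a::euclidean_space \<Rightarrow> real"
  assumes "f differentiable (at x)"
  shows "GDERIV f x :> gradient f x"
proof -
  obtain f' where f': "(f has_derivative f') (at x)"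
    using assms by (auto simp: differentiable_def)
  interpret bounded_linear f'
    using f' by (rule has_derivative_bounded_linear)
  define g where "g = (\<Sum>b\<in>Basis. f' b *\<^sub>R b)"
  have "f' v = v \<bullet> g" for v
  proof -
    have "f' v = f' (\<Sum>b\<in>Basis. (v \<bullet> b) *\<^sub>R b)"
      by (simp add: euclidean_representation)
    also have "\<dots> = v \<bullet> g"
      by (simp add: g_def sum scale inner_sum_right mult.commute)
    finally show ?thesis .
  qed
  then have "f' = (\<lambda>v. v \<bullet> g)"
    by auto
  with f' have g: "GDERIV f x :> g"
    by (simp add: gderiv_def)
  have "g' = g" if "GDERIV f x :> g'" for g'
  proof -
    have "(\<lambda>v. v \<bullet> g') = (\<lambda>v. v \<bullet> g)"
      using that g unfolding gderiv_def by (rule has_derivative_unique)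
    then show ?thesis
      by (metis inner_commute vector_eq_rdot)
  qed
  with g show ?thesis
    unfolding gradient_def by (rule theI)
qed

text \<open>The gap \<open>p\<close> between \<open>f\<close> and its quadratic model along the
  segment has nonpositive derivative, by Cauchy-Schwarz and the Lipschitz gradient. Monotonicity of
  \<open>p\<close> replaces integration.\<close>

lemma smooth_with_upper_bound:
  fixes f :: "'a::euclidean_space \<Rightarrow> real"
  assumes "smooth_with L f"
  shows "f y \<le> f x + gradient f x \<bullet> (y - x) + L / 2 * (norm (y - x))\<^sup>2"
proof -
  define v where "v = y - x"
  define p where "p = (\<lambda>s. f (x + s *\<^sub>R v) - (s * (gradient f x \<bullet> v) + L / 2 * s\<^sup>2 * (norm v)\<^sup>2))"
  have "p 1 \<le> p 0"
  proof (rule DERIV_nonpos_imp_nonincreasing [where f = p and a = 0 and b = 1])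
    fix s :: real assume "0 \<le> s" "s \<le> 1"
    have "GDERIV f (x + s *\<^sub>R v) :> gradient f (x + s *\<^sub>R v)"
      using assms by (intro GDERIV_gradient) (auto simp: smooth_with_def)
    then have outer: "(f has_derivative (\<lambda>w. w \<bullet> gradient f (x + s *\<^sub>R v))) (at (x + s *\<^sub>R v))"
      by (simp add: gderiv_def)
    have inner: "((\<lambda>s. x + s *\<^sub>R v) has_derivative (\<lambda>u. u *\<^sub>R v)) (at s)"
      by (auto intro!: derivative_eq_intros)
    have "((\<lambda>s. f (x + s *\<^sub>R v)) has_derivative
        (\<lambda>u. (u *\<^sub>R v) \<bullet> gradient f (x + s *\<^sub>R v))) (at s)"
      by (rule has_derivative_compose [OF inner outer])
    moreover have "(u *\<^sub>R v) \<bullet> w = (w \<bullet> v) * u" for u w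
      by (simp add: inner_commute [of v])
    ultimately have "((\<lambda>s. f (x + s *\<^sub>R v)) has_real_derivative gradient f (x + s *\<^sub>R v) \<bullet> v) (at s)"
      by (simp only: has_field_derivative_def)
    moreover have "((\<lambda>s. s * (gradient f x \<bullet> v) + L / 2 * s\<^sup>2 * (norm v)\<^sup>2) has_real_derivative
        gradient f x \<bullet> v + L * s * (norm v)\<^sup>2) (at s)"
      by (auto intro!: derivative_eq_intros)
    ultimately have "(p has_real_derivative gradient f (x + s *\<^sub>R v) \<bullet> v
        - (gradient f x \<bullet> v + L * s * (norm v)\<^sup>2)) (at s)"
      unfolding p_def by (rule DERIV_diff)
    moreover have "gradient f (x + s *\<^sub>R v) \<bullet> v - (gradient f x \<bullet> v + L * s * (norm v)\<^sup>2) \<le> 0"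
    proof -
      have "(gradient f (x + s *\<^sub>R v) - gradient f x) \<bullet> v
          \<le> norm (gradient f (x + s *\<^sub>R v) - gradient f x) * norm v"
        by (rule norm_cauchy_schwarz)
      also have "\<dots> \<le> L * norm ((x + s *\<^sub>R v) - x) * norm v"
        using assms unfolding smooth_with_def by (intro mult_right_mono norm_ge_zero) blast
      also have "\<dots> = L * s * (norm v)\<^sup>2"
        using \<open>0 \<le> s\<close> by (simp add: power2_eq_square)
      finally show ?thesis
        by (simp add: inner_diff_left)
    qed
    ultimately show "\<exists>d. DERIV p s :> d \<and> d \<le> 0"
      by blast
  qed simp
  then show ?thesis
    by (simp add: p_def v_def)
qed

section \<open>Lower semicontinuity and existence of proximal points\<close>

lemma ereal_lsc_eventually:
  assumes "ereal_lsc h" "C < h z"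
  shows "eventually (\<lambda>y. C < h y) (nhds z)"
  using assms unfolding ereal_lsc_def le_Liminf_iff eventually_nhds_conv_at by blast

text \<open>Without a minimum, the open sets where \<phi> exceeds \<open>\<phi> w\<close>, for
  \<open>w\<close> in \<open>K\<close>, cover \<open>K\<close>. In a finite subcover the
  \<open>w\<close> of least value is itself left uncovered.\<close>

lemma ereal_lsc_attains_min:
  fixes \<phi> :: "'a::topological_space \<Rightarrow> ereal"
  assumes "ereal_lsc \<phi>" "compact K" "K \<noteq> {}"
  shows "\<exists>p\<in>K. \<forall>z\<in>K. \<phi> p \<le> \<phi> z"
proof (rule ccontr)
  assume "\<not> ?thesis"
  then have no_min: "\<exists>w\<in>K. \<phi> w < \<phi> z" if "z \<in> K" for z
    using that by (meson not_le)
  have "open {z. C < \<phi> z}" for C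
  proof (subst open_subopen, intro ballI)
    fix z assume "z \<in> {z. C < \<phi> z}"
    with ereal_lsc_eventually [OF assms(1)] show "\<exists>T. open T \<and> z \<in> T \<and> T \<subseteq> {z. C < \<phi> z}"
      by (force simp: eventually_nhds)
  qed
  moreover have "K \<subseteq> (\<Union>w\<in>K. {z. \<phi> w < \<phi> z})"
    using no_min by blast
  ultimately obtain W where W: "W \<subseteq> K" "finite W" "K \<subseteq> (\<Union>w\<in>W. {z. \<phi> w < \<phi> z})"
    using compactE_image [OF assms(2)] by metis
  with assms(3) have "W \<noteq> {}"
    by auto
  then obtain w where w: "w \<in> W" "\<And>w'. w' \<in> W \<Longrightarrow> \<phi> w \<le> \<phi> w'"
    using W(2) by (metis arg_min_if_finite(1) arg_min_least)
  with W show False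
    by (auto simp: subset_iff leD)
qed

lemma ereal_lsc_continuous_add:
  fixes h :: "'a::topological_space \<Rightarrow> ereal"
  assumes "continuous_on UNIV q" "ereal_lsc h" "\<And>z. h z \<noteq> -\<infinity>"
  shows "ereal_lsc (\<lambda>z. ereal (q z) + h z)"
  unfolding ereal_lsc_def le_Liminf_iff
proof (intro allI impI)
  fix z C assume "C < ereal (q z) + h z"
  then obtain c where c: "C < ereal c" "ereal c < ereal (q z) + h z"
    using ereal_dense2 by blast
  then have "ereal (c - q z) < h z"
    by (cases "h z") auto
  \<comment> \<open>The slack above \<open>c\<close> is divided at \<open>c'\<close>: the bounds
    \<open>c' < h y\<close> and \<open>c - c' < q y\<close> can be ensured separately and add up to
    more than \<open>c\<close>.\<close>
  then obtain c' where c': "ereal (c - q z) < ereal c'" "ereal c' < h z"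
    using ereal_dense2 by blast
  have "(q \<longlongrightarrow> q z) (at z)"
    using assms(1) by (simp add: continuous_on_def)
  then have "eventually (\<lambda>y. c - c' < q y) (at z)"
    using c'(1) by (intro order_tendstoD) auto
  moreover have "eventually (\<lambda>y. ereal c' < h y) (at z)"
    using assms(2) c'(2) unfolding ereal_lsc_def le_Liminf_iff by blast
  ultimately show "eventually (\<lambda>y. C < ereal (q y) + h y) (at z)"
  proof eventually_elim
    case (elim y)
    have "ereal c < ereal (q y) + h y"
      using elim by (cases "h y") auto
    with c(1) show ?case
      by order
  qed
qed

text \<open>Points outside the unit ball are compared along the segment to \<open>a\<close> with the point where it
  meets the unit sphere, on which \<open>h\<close> is bounded below by compactness.\<close>

lemma ereal_convex_lsc_minorant:
  fixes h :: "'a::euclidean_space \<Rightarrow> ereal"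
  assumes proper: "ereal_proper h" and cvx: "ereal_convex h" and lsc: "ereal_lsc h"
    and a: "a \<in> effective_domain h"
  obtains m B where "\<And>z. ereal (m - B * norm (z - a)) \<le> h z" "0 \<le> B"
proof -
  have ninf: "h z \<noteq> -\<infinity>" for z
    using proper by (simp add: ereal_proper_def)
  obtain v where v: "h a = ereal v"
    using a ninf [of a] by (cases "h a") (auto simp: effective_domain_def)
  obtain p where p: "p \<in> cball a 1" "\<And>z. z \<in> cball a 1 \<Longrightarrow> h p \<le> h z"
    using ereal_lsc_attains_min [OF lsc compact_cball [of a 1]] by auto
  obtain m where m: "h p = ereal m"
    using p(2) [of a] v ninf [of p] by (cases "h p") auto
  have "m \<le> v"
    using p(2) [of a] v m by simp
  \<comment> \<open>The slope \<open>v - m\<close> is the drop of \<open>h\<close> from the centre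
    to its minimum on the unit ball; by convexity \<open>h\<close> cannot fall faster than this
    outside the ball.\<close>
  have "ereal (m - (v - m) * norm (z - a)) \<le> h z" for z
  proof (cases "norm (z - a) \<le> 1")
    case True
    then have "ereal m \<le> h z"
      using p(2) [of z] m by (simp add: dist_norm norm_minus_commute)
    moreover have "m - (v - m) * norm (z - a) \<le> m"
      using \<open>m \<le> v\<close> by simp
    ultimately show ?thesis
      by (meson ereal_less_eq(3) order_trans)
  next
    case False
    define r where "r = norm (z - a)"
    have r: "r > 1"
      using False by (simp add: r_def)
    define w where "w = (1 - 1 / r) *\<^sub>R a + (1 / r) *\<^sub>R z"
    have "w - a = (1 / r) *\<^sub>R (z - a)"
      by (simp add: w_def algebra_simps)
    then have "norm (w - a) = 1 / r * r"
      using r by (simp add: r_def)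
    then have "norm (w - a) = 1"
      using r by simp
    then have "ereal m \<le> h w"
      using p(2) [of w] m by (simp add: dist_norm norm_minus_commute)
    also have "h w \<le> ereal (1 - 1 / r) * h a + ereal (1 / r) * h z"
      unfolding w_def using cvx r by (auto simp: ereal_convex_def)
    finally have *: "ereal m \<le> ereal (1 - 1 / r) * h a + ereal (1 / r) * h z" .
    show ?thesis
    proof (cases "h z")
      case (real y)
      have "m \<le> (1 - 1 / r) * v + 1 / r * y"
        using * v real by simp
      then have "r * m \<le> r * ((1 - 1 / r) * v + 1 / r * y)"
        using r by (intro mult_left_mono) auto
      also have "\<dots> = (r - 1) * v + y"
        using r by (simp add: field_simps)
      finally have "r * m \<le> (r - 1) * v + y" .
      then show ?thesis
        using \<open>m \<le> v\<close> real by (simp add: r_def [symmetric] algebra_simps)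
    qed (use ninf in auto)
  qed
  with \<open>m \<le> v\<close> show thesis
    using that [of m "v - m"] by simp
qed

lemma prox_model_minimizer_exists:
  fixes h :: "'a::euclidean_space \<Rightarrow> ereal" and g a :: 'a and c :: real
  defines "\<phi> \<equiv> \<lambda>z. ereal (g \<bullet> z + c * (norm (z - a))\<^sup>2) + h z"
  assumes h: "ereal_proper h" "ereal_convex h" "ereal_lsc h"
    and a: "a \<in> effective_domain h" and "c > 0"
  shows "\<exists>p. \<forall>z. \<phi> p \<le> \<phi> z"
proof -
  have ninf: "h z \<noteq> -\<infinity>" for z
    using h(1) by (simp add: ereal_proper_def)
  obtain v where v: "h a = ereal v"
    using a ninf [of a] by (cases "h a") (auto simp: effective_domain_def)
  obtain m B where mB: "\<And>z. ereal (m - B * norm (z - a)) \<le> h z" "0 \<le> B"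
    using ereal_convex_lsc_minorant [OF h a] by blast
  \<comment> \<open>From \<open>R\<close> on, the quadratic beats both linear terms: the quotient
    gives \<open>\<bar>v - m\<bar> \<le> c * r - (norm g + B)\<close>, and the floor 1 allows the
    right-hand side to be multiplied by \<open>r\<close>. A minimizer over the ball is then
    global.\<close>
  define R where "R = max 1 ((norm g + B + \<bar>v - m\<bar>) / c)"
  have far: "\<phi> a \<le> \<phi> z" if "R \<le> norm (z - a)" for z
  proof -
    define r where "r = norm (z - a)"
    have r: "1 \<le> r" "(norm g + B + \<bar>v - m\<bar>) / c \<le> r"
      using that by (auto simp: R_def r_def)
    then have "norm g + B + \<bar>v - m\<bar> \<le> c * r"
      using \<open>c > 0\<close> by (simp add: field_simps)
    then have "\<bar>v - m\<bar> \<le> c * r - (norm g + B)"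
      by linarith
    also have "\<dots> \<le> (c * r - (norm g + B)) * r"
      using r(1) calculation mult_left_mono [of 1 r "c * r - (norm g + B)"] by simp
    finally have "v \<le> c * r\<^sup>2 - norm g * r - B * r + m"
      by (simp add: algebra_simps power2_eq_square)
    moreover have "- (norm g * r) \<le> g \<bullet> (z - a)"
      using Cauchy_Schwarz_ineq2 [of g "z - a"] by (simp add: r_def)
    ultimately have "g \<bullet> a + v \<le> g \<bullet> z + c * r\<^sup>2 + (m - B * r)"
      by (simp add: inner_diff_right)
    then have "\<phi> a \<le> ereal (g \<bullet> z + c * r\<^sup>2) + ereal (m - B * r)"
      by (simp add: \<phi>_def v)
    also have "\<dots> \<le> \<phi> z"
      unfolding \<phi>_def r_def using mB(1) by (intro add_left_mono)
    finally show ?thesis .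
  qed
  have "ereal_lsc \<phi>"
    unfolding \<phi>_def using h(3) ninf by (intro ereal_lsc_continuous_add continuous_intros)
  moreover have "cball a R \<noteq> {}"
    by (simp add: R_def)
  ultimately have "\<exists>p\<in>cball a R. \<forall>z\<in>cball a R. \<phi> p \<le> \<phi> z"
    by (intro ereal_lsc_attains_min) auto
  then obtain p where p: "\<And>z. z \<in> cball a R \<Longrightarrow> \<phi> p \<le> \<phi> z"
    by metis
  have "\<phi> p \<le> \<phi> a"
    by (intro p) (simp add: R_def)
  have "\<phi> p \<le> \<phi> z" for z
  proof (cases "z \<in> cball a R")
    case False
    then have "R \<le> norm (z - a)"
      by (simp add: dist_norm norm_minus_commute)
    with far \<open>\<phi> p \<le> \<phi> a\<close> show ?thesis
      by (blast intro: order_trans)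
  qed (rule p)
  then show ?thesis
    by blast
qed

section \<open>Quadratic growth at proximal points and the forward step\<close>

lemma norm_convex_combination_power2:
  fixes p z :: "'a::real_inner"
  shows "(norm ((1 - u) *\<^sub>R p + u *\<^sub>R z))\<^sup>2
    = (1 - u) * (norm p)\<^sup>2 + u * (norm z)\<^sup>2 - u * (1 - u) * (norm (z - p))\<^sup>2"
  unfolding power2_norm_eq_inner
  by (simp add: inner_simps inner_commute [of z p] algebra_simps)

text \<open>Minimality of \<open>p\<close> is tested against points on the segment towards
  \<open>z\<close>. Dividing by \<open>u\<close> leaves the growth term with factor
  \<open>1 - u\<close>, and letting \<open>u\<close> tend to 0 recovers the full coefficient
  \<open>c\<close>.\<close>

lemma prox_model_strong_minimum:
  fixes h :: "'a::real_inner \<Rightarrow> ereal" and g a p z :: 'a and c :: real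
  defines "\<phi> \<equiv> \<lambda>z. ereal (g \<bullet> z + c * (norm (z - a))\<^sup>2) + h z"
  assumes cvx: "ereal_convex h" and min: "\<And>z. \<phi> p \<le> \<phi> z"
    and hp: "h p = ereal hp" and hz: "h z = ereal hz"
  shows "g \<bullet> p + c * (norm (p - a))\<^sup>2 + hp + c * (norm (z - p))\<^sup>2
    \<le> g \<bullet> z + c * (norm (z - a))\<^sup>2 + hz"
proof -
  define A where "A = g \<bullet> p + c * (norm (p - a))\<^sup>2 + hp"
  define B where "B = g \<bullet> z + c * (norm (z - a))\<^sup>2 + hz"
  define N where "N = c * (norm (z - p))\<^sup>2"
  have *: "A + (1 - u) * N \<le> B" if u: "0 < u" "u < 1" for u
  proof -
    define w where "w = (1 - u) *\<^sub>R p + u *\<^sub>R z"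
    have "w - a = (1 - u) *\<^sub>R (p - a) + u *\<^sub>R (z - a)"
      by (simp add: w_def algebra_simps)
    then have nw: "(norm (w - a))\<^sup>2 = (1 - u) * (norm (p - a))\<^sup>2 + u * (norm (z - a))\<^sup>2
        - u * (1 - u) * (norm (z - p))\<^sup>2"
      using norm_convex_combination_power2 [of u "p - a" "z - a"] by simp
    have gw: "g \<bullet> w = (1 - u) * (g \<bullet> p) + u * (g \<bullet> z)"
      by (simp add: w_def inner_simps)
    have "h w \<le> ereal (1 - u) * h p + ereal u * h z"
      unfolding w_def using cvx u by (auto simp: ereal_convex_def)
    then have hw: "h w \<le> ereal ((1 - u) * hp + u * hz)"
      by (simp add: hp hz)
    have "ereal A \<le> \<phi> w"
      using min [of w] by (simp add: \<phi>_def A_def hp)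
    also have "\<dots> \<le> ereal (g \<bullet> w + c * (norm (w - a))\<^sup>2) + ereal ((1 - u) * hp + u * hz)"
      unfolding \<phi>_def using hw by (intro add_left_mono)
    also have "\<dots> = ereal ((1 - u) * A + u * B - u * (1 - u) * N)"
      by (simp add: nw gw A_def B_def N_def algebra_simps)
    finally have "u * (A + (1 - u) * N) \<le> u * B"
      by (simp add: algebra_simps)
    with u show ?thesis
      by simp
  qed
  have "((\<lambda>u. A + (1 - u) * N) \<longlongrightarrow> A + (1 - 0) * N) (at_right 0)"
    by (intro tendsto_intros)
  moreover have "eventually (\<lambda>u. A + (1 - u) * N \<le> B) (at_right (0::real))"
    using * by (auto simp: eventually_at_right_field intro!: exI [of _ 1])
  ultimately have "A + (1 - 0) * N \<le> B"
    by (intro tendsto_upperbound) auto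
  then show ?thesis
    by (simp add: A_def B_def N_def)
qed

text \<open>\<open>arg_min\<close> is a choice operator. Since the strict order of values is
  preserved, both sides choose from the same predicate, so the results agree without any uniqueness
  of minimizers.\<close>

lemma arg_min_affine_rescale:
  fixes \<phi> \<psi> :: "'a \<Rightarrow> ereal"
  assumes "\<alpha> > 0" and \<psi>: "\<And>z. \<psi> z = ereal \<alpha> * \<phi> z + ereal \<beta>"
  shows "arg_min \<psi> P = arg_min \<phi> P"
proof -
  have "\<psi> y < \<psi> z \<longleftrightarrow> \<phi> y < \<phi> z" for y z
    unfolding \<psi> using \<open>\<alpha> > 0\<close>
    by (cases "\<phi> y"; cases "\<phi> z") auto
  then show ?thesis
    by (simp add: arg_min_def is_arg_min_def)
qed

text \<open>Completing the square: the two objectives differ by the factor \<alpha> and the constant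
  \<beta>. This identifies the iterates with the proximal points in the gradient mapping.\<close>

lemma prox_forward_step:
  fixes h :: "'a::real_inner \<Rightarrow> ereal"
  assumes "\<alpha> > 0" and ninf: "\<And>z. h z \<noteq> -\<infinity>"
  shows "prox (\<lambda>z. ereal \<alpha> * h z) (a - \<alpha> *\<^sub>R g)
    = arg_min (\<lambda>z. ereal (g \<bullet> z + 1 / (2 * \<alpha>) * (norm (z - a))\<^sup>2) + h z) (\<lambda>_. True)"
  unfolding prox_def
proof (rule arg_min_affine_rescale [OF \<open>\<alpha> > 0\<close>])
  fix z
  define q where "q = g \<bullet> z + 1 / (2 * \<alpha>) * (norm (z - a))\<^sup>2"
  define \<beta> where "\<beta> = \<alpha>\<^sup>2 / 2 * (norm g)\<^sup>2 - \<alpha> * (g \<bullet> a)"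
  define w where "w = z - a"
  have "z - (a - \<alpha> *\<^sub>R g) = w + \<alpha> *\<^sub>R g"
    by (simp add: w_def)
  then have "(norm (z - (a - \<alpha> *\<^sub>R g)))\<^sup>2 = (norm w)\<^sup>2 + 2 * \<alpha> * (g \<bullet> w) + \<alpha>\<^sup>2 * (norm g)\<^sup>2"
    by (simp only: power2_norm_eq_inner)
      (simp add: inner_add_left inner_add_right inner_commute [of w g] power2_eq_square distrib_left)
  moreover have "\<alpha> * q = \<alpha> * (g \<bullet> z) + 1 / 2 * (norm w)\<^sup>2"
    using \<open>\<alpha> > 0\<close> by (simp add: q_def w_def distrib_left)
  ultimately have "1 / 2 * (norm (z - (a - \<alpha> *\<^sub>R g)))\<^sup>2 = \<alpha> * q + \<beta>"
    by (simp add: \<beta>_def w_def inner_diff_right right_diff_distrib)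
  moreover have "ereal \<alpha> * h z + ereal (\<alpha> * q + \<beta>) = ereal \<alpha> * (ereal q + h z) + ereal \<beta>"
    using \<open>\<alpha> > 0\<close> ninf [of z] by (cases "h z") (simp_all add: distrib_left)
  ultimately show "ereal \<alpha> * h z + ereal (1 / 2 * (norm (z - (a - \<alpha> *\<^sub>R g)))\<^sup>2)
      = ereal \<alpha> * (ereal (g \<bullet> z + 1 / (2 * \<alpha>) * (norm (z - a))\<^sup>2) + h z)
        + ereal (\<alpha>\<^sup>2 / 2 * (norm g)\<^sup>2 - \<alpha> * (g \<bullet> a))"
    by (simp only: q_def \<beta>_def)
qed

section \<open>The scalar recursion for the step sizes\<close>

lemma diff_one_le_mult_ln:
  fixes r :: real
  assumes "r > 0"
  shows "r - 1 \<le> r * ln r"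
proof -
  have "ln (1 / r) \<le> 1 / r - 1"
    using assms by (intro ln_le_minus_one) simp
  then have "1 - 1 / r \<le> ln r"
    using assms by (simp add: ln_div)
  then have "r * (1 - 1 / r) \<le> r * ln r"
    using assms by (intro mult_left_mono) auto
  with assms show ?thesis
    by (simp add: algebra_simps)
qed

text \<open>The scalar recursion behind the method: \<open>\<Phi> k\<close> stands for \<open>F (x k) - F*\<close> and \<open>d k\<close> for
  \<open>norm (x (k + 1) - x k)\<close>.\<close>

locale adaptive_descent =
  fixes \<Phi> S d :: "nat \<Rightarrow> real" and L \<gamma> \<eta> D M :: real
  assumes L_pos: "L > 0" and \<gamma>_pos: "\<gamma> > 0" and \<eta>_pos: "\<eta> > 0" and D_pos: "D > 0"
    and S_1: "S 1 = \<gamma>" and S_pos: "k \<ge> 1 \<Longrightarrow> S k > 0"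
    and S_step: "k \<ge> 1 \<Longrightarrow> (S (Suc k))\<^sup>2 = (S k)\<^sup>2 * (1 + (d k)\<^sup>2 / \<eta>\<^sup>2)"
    and d_nonneg: "d k \<ge> 0" and d_le: "k \<ge> 1 \<Longrightarrow> d k \<le> D"
    and \<Phi>_nonneg: "k \<ge> 1 \<Longrightarrow> \<Phi> k \<ge> 0"
    and descent: "k \<ge> 1 \<Longrightarrow> \<Phi> (Suc k) \<le> \<Phi> k + (L / 2 - S k / \<eta>) * (d k)\<^sup>2"
    and M_def: "M = \<Phi> 1 + max 0 (L * (\<eta>\<^sup>2 + D\<^sup>2) * ln (L * \<eta> / (2 * \<gamma>)) + L * D\<^sup>2 / 2)"
begin

lemma S_mono_step:
  assumes "k \<ge> 1"
  shows "S k \<le> S (Suc k)"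
proof (rule power2_le_imp_le)
  show "(S k)\<^sup>2 \<le> (S (Suc k))\<^sup>2"
    using assms by (simp add: S_step mult_le_cancel_left1)
  show "0 \<le> S (Suc k)"
    using S_pos [of "Suc k"] by simp
qed

lemma S_step_le:
  assumes "k \<ge> 1"
  shows "S (Suc k) \<le> S k * (1 + D / \<eta>)"
proof (rule power2_le_imp_le)
  have "1 + (d k)\<^sup>2 / \<eta>\<^sup>2 \<le> 1 + D\<^sup>2 / \<eta>\<^sup>2"
    using d_le [OF assms] d_nonneg [of k] by (auto intro!: divide_right_mono power_mono)
  also have "\<dots> \<le> (1 + D / \<eta>)\<^sup>2"
    using D_pos \<eta>_pos by (simp add: power2_sum power_divide)
  finally show "(S (Suc k))\<^sup>2 \<le> (S k * (1 + D / \<eta>))\<^sup>2"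
    using S_pos [OF assms] unfolding S_step [OF assms] power_mult_distrib
    by (intro mult_left_mono) auto
  show "0 \<le> S k * (1 + D / \<eta>)"
    using S_pos [OF assms] D_pos \<eta>_pos by simp
qed

lemma step_power2_eq:
  assumes "k \<ge> 1"
  shows "(d k)\<^sup>2 * (S k)\<^sup>2 = \<eta>\<^sup>2 * (S (Suc k) - S k) * (S (Suc k) + S k)"
proof -
  have "\<eta>\<^sup>2 * (S (Suc k))\<^sup>2 = (S k)\<^sup>2 * (\<eta>\<^sup>2 + (d k)\<^sup>2)"
    using \<eta>_pos by (simp add: S_step [OF assms] field_simps)
  then show ?thesis
    by (simp add: algebra_simps power2_eq_square)
qed

text \<open>Turns squared steps into telescoping logarithms. With \<open>r\<close> the squared ratio
  of consecutive \<open>S\<close>, the bound \<open>r - 1 \<le> r * ln r\<close> applies, and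
  \<open>\<eta>\<^sup>2 * r\<close> equals \<open>\<eta>\<^sup>2 + (d k)\<^sup>2\<close>.\<close>

lemma step_power2_le_ln:
  assumes "k \<ge> 1"
  shows "(d k)\<^sup>2 \<le> 2 * (\<eta>\<^sup>2 + D\<^sup>2) * (ln (S (Suc k)) - ln (S k))"
proof -
  define r where "r = 1 + (d k)\<^sup>2 / \<eta>\<^sup>2"
  have "r \<ge> 1"
    by (simp add: r_def)
  have S: "S k > 0" "S (Suc k) > 0"
    using S_pos [OF assms] S_pos [of "Suc k"] by auto
  have "ln ((S (Suc k))\<^sup>2) = ln ((S k)\<^sup>2 * r)"
    by (simp add: S_step [OF assms] r_def)
  then have ln_r: "ln r = 2 * (ln (S (Suc k)) - ln (S k))"
    using S \<open>r \<ge> 1\<close> by (simp add: ln_mult ln_realpow)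
  have dr: "(d k)\<^sup>2 = \<eta>\<^sup>2 * (r - 1)"
    using \<eta>_pos by (simp add: r_def)
  also have "\<dots> \<le> \<eta>\<^sup>2 * (r * ln r)"
    using \<open>r \<ge> 1\<close> by (intro mult_left_mono diff_one_le_mult_ln) auto
  also have "\<dots> = (\<eta>\<^sup>2 + (d k)\<^sup>2) * ln r"
    by (simp add: dr algebra_simps)
  also have "\<dots> \<le> (\<eta>\<^sup>2 + D\<^sup>2) * ln r"
    using d_le [OF assms] d_nonneg [of k] \<open>r \<ge> 1\<close>
    by (auto intro!: mult_right_mono power_mono)
  finally show ?thesis
    unfolding ln_r by (simp only: mult_ac)
qed

lemma gap_le:
  assumes "k \<ge> 1"
  shows "\<Phi> k \<le> M"
proof -
  let ?C = "L * (\<eta>\<^sup>2 + D\<^sup>2)"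
  have "?C > 0"
    using L_pos D_pos by (auto intro!: mult_pos_pos add_nonneg_pos)
  txt \<open>The second conjunct is what makes the induction go through while \<open>S\<close> is small.\<close>
  have "\<Phi> k \<le> M \<and> (S k \<le> L * \<eta> / 2 \<longrightarrow> \<Phi> k \<le> \<Phi> 1 + ?C * ln (S k / \<gamma>))"
    using assms
  proof (induction k rule: nat_induct_at_least)
    case base
    show ?case
      using \<gamma>_pos by (simp add: S_1 [simplified] M_def)
  next
    case (Suc k)
    have S: "S k > 0" "S (Suc k) > 0" "S k \<le> S (Suc k)"
      using S_pos S_mono_step Suc.hyps by auto
    show ?case
    proof (cases "S k \<le> L * \<eta> / 2")
      case True
      have gap: "\<Phi> k \<le> \<Phi> 1 + ?C * ln (S k / \<gamma>)"
        using Suc.IH True by blast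
      have "0 \<le> S k / \<eta> * (d k)\<^sup>2"
        using S(1) \<eta>_pos by simp
      then have step: "\<Phi> (Suc k) \<le> \<Phi> k + L / 2 * (d k)\<^sup>2"
        using descent [OF Suc.hyps] by (simp add: left_diff_distrib)
      have "S k / \<gamma> \<le> L * \<eta> / (2 * \<gamma>)"
        using True \<gamma>_pos by (simp add: field_simps)
      then have "?C * ln (S k / \<gamma>) \<le> ?C * ln (L * \<eta> / (2 * \<gamma>))"
        using \<open>?C > 0\<close> S(1) \<gamma>_pos L_pos \<eta>_pos by (intro mult_left_mono) auto
      \<comment> \<open>This step may carry \<open>S\<close> past the threshold, where the logarithm
        is no longer controlled. Its increase is therefore bounded through \<open>D\<close>, which
        is the source of \<open>L * D\<^sup>2 / 2\<close> in \<open>M\<close>.\<close>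
      moreover have "L / 2 * (d k)\<^sup>2 \<le> L / 2 * D\<^sup>2"
        using d_le [OF Suc.hyps] d_nonneg [of k] L_pos by (intro mult_left_mono power_mono) auto
      ultimately have "\<Phi> (Suc k) \<le> M"
        using gap step unfolding M_def by (simp add: max_def)
      moreover have "L / 2 * (d k)\<^sup>2 \<le> L / 2 * (2 * (\<eta>\<^sup>2 + D\<^sup>2) * (ln (S (Suc k)) - ln (S k)))"
        using L_pos by (intro mult_left_mono step_power2_le_ln Suc.hyps) auto
      then have "\<Phi> (Suc k) \<le> \<Phi> 1 + ?C * ln (S (Suc k) / \<gamma>)"
        using gap step S \<gamma>_pos by (simp add: ln_div algebra_simps)
      ultimately show ?thesis
        by blast
    next
      case False
      then have "L / 2 - S k / \<eta> \<le> 0"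
        using \<eta>_pos by (simp add: field_simps)
      then have "(L / 2 - S k / \<eta>) * (d k)\<^sup>2 \<le> 0"
        by (simp add: mult_nonpos_nonneg)
      then have "\<Phi> (Suc k) \<le> M"
        using descent [OF Suc.hyps] Suc.IH by linarith
      \<comment> \<open>By monotonicity \<open>S\<close> stays above the threshold, so the second
        conjunct is vacuous.\<close>
      with False S(3) show ?thesis
        by auto
    qed
  qed
  then show ?thesis
    by blast
qed

text \<open>With increment \<delta> and \<open>s = S k\<close>, \<open>step_power2_eq\<close> gives
  \<open>(d k)\<^sup>2 * s\<^sup>2 = \<eta>\<^sup>2 * \<delta> * (2 * s + \<delta>)\<close>.
  Dropping the square of \<delta> bounds the step from below, which is usable because the descent
  coefficient has the right sign above \<open>L * \<eta> / 2\<close>.\<close>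

lemma gap_decrease:
  assumes "k \<ge> 1" and "L * \<eta> / 2 \<le> S k"
  shows "\<Phi> (Suc k) \<le> \<Phi> k - \<eta> * (2 * (S (Suc k) - S k) * (1 - L * \<eta> / 2 / S k))"
proof -
  define s where "s = S k"
  define \<delta> where "\<delta> = S (Suc k) - S k"
  have s: "s > 0" "\<delta> \<ge> 0"
    using S_pos [OF assms(1)] S_mono_step [OF assms(1)] by (auto simp: s_def \<delta>_def)
  have "2 * s * \<delta> \<le> (S (Suc k) - S k) * (S (Suc k) + S k)"
    by (simp add: s_def \<delta>_def algebra_simps) (use sum_squares_ge_zero [of "S (Suc k) - S k" 0] in
      \<open>simp add: algebra_simps\<close>)
  then have "\<eta>\<^sup>2 * (2 * s * \<delta>) \<le> (d k)\<^sup>2 * s\<^sup>2"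
    using step_power2_eq [OF assms(1)] mult_left_mono [of "2 * s * \<delta>" _ "\<eta>\<^sup>2"]
    by (simp add: s_def mult.assoc)
  then have "\<eta>\<^sup>2 * (2 * \<delta>) \<le> (d k)\<^sup>2 * s"
    using s(1) by (simp add: power2_eq_square [of s] mult_le_cancel_right
        flip: mult.assoc)
  then have "\<eta>\<^sup>2 * (2 * \<delta>) * ((1 - L * \<eta> / 2 / s) / \<eta>) \<le> (d k)\<^sup>2 * s * ((1 - L * \<eta> / 2 / s) / \<eta>)"
    using s \<eta>_pos assms(2) by (intro mult_right_mono) (auto simp: s_def field_simps)
  moreover have "(d k)\<^sup>2 * s * ((1 - L * \<eta> / 2 / s) / \<eta>) = (s / \<eta> - L / 2) * (d k)\<^sup>2"
    using s(1) \<eta>_pos by (simp add: field_simps)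
  moreover have "\<eta>\<^sup>2 * (2 * \<delta>) * ((1 - L * \<eta> / 2 / s) / \<eta>) = \<eta> * (2 * \<delta> * (1 - L * \<eta> / 2 / s))"
    using \<eta>_pos by (simp add: power2_eq_square)
  ultimately show ?thesis
    using descent [OF assms(1)] by (simp add: s_def \<delta>_def left_diff_distrib)
qed

text \<open>Above \<open>L * \<eta>\<close> the factor \<open>2 * (1 - L * \<eta> / 2 / S k)\<close>
  is at least 1, so the decrease in \<open>\<Phi> / \<eta>\<close> pays for the whole growth of
  \<open>S\<close>.\<close>

lemma potential_decreasing:
  assumes "k \<ge> 1" and "L * \<eta> \<le> S k"
  shows "S (Suc k) + \<Phi> (Suc k) / \<eta> \<le> S k + \<Phi> k / \<eta>"
proof -
  have "1 \<le> 2 * (1 - L * \<eta> / 2 / S k)"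
    using assms(2) S_pos [OF assms(1)] by (simp add: field_simps)
  then have "(S (Suc k) - S k) * 1 \<le> (S (Suc k) - S k) * (2 * (1 - L * \<eta> / 2 / S k))"
    using S_mono_step [OF assms(1)] by (intro mult_left_mono) auto
  then have "S (Suc k) - S k \<le> 2 * (S (Suc k) - S k) * (1 - L * \<eta> / 2 / S k)"
    by (simp only: mult_ac mult_1)
  then have "\<eta> * (S (Suc k) - S k) \<le> \<eta> * (2 * (S (Suc k) - S k) * (1 - L * \<eta> / 2 / S k))"
    using \<eta>_pos by (intro mult_left_mono) auto
  moreover have "L * \<eta> / 2 \<le> S k"
    using assms(2) L_pos \<eta>_pos mult_pos_pos [of L \<eta>] by linarith
  ultimately have "\<Phi> (Suc k) + \<eta> * (S (Suc k) - S k) \<le> \<Phi> k"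
    using gap_decrease [OF assms(1)] by linarith
  then have "(\<Phi> (Suc k) + \<eta> * (S (Suc k) - S k)) / \<eta> \<le> \<Phi> k / \<eta>"
    using \<eta>_pos by (intro divide_right_mono) auto
  then show ?thesis
    using \<eta>_pos by (simp add: add_divide_distrib)
qed

text \<open>Once \<open>S\<close> exceeds \<open>L * \<eta> / 2\<close>, the descent during the step that carries \<open>S\<close> past \<open>L * \<eta>\<close>
  already pays for half of the overshoot; this is why the bound has \<open>L * D / 2\<close>
  instead of \<open>L * D\<close>.\<close>

lemma potential_after_crossing:
  assumes "k \<ge> 1" and "S k \<le> L * \<eta>"
  shows "S (Suc k) + \<Phi> (Suc k) / \<eta> \<le> M / \<eta> + L * \<eta> + L * D / 2"
proof (cases "S k \<le> L * \<eta> / 2")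
  case True
  have "S (Suc k) \<le> S k * (1 + D / \<eta>)"
    by (rule S_step_le [OF assms(1)])
  also have "\<dots> \<le> L * \<eta> / 2 * (1 + D / \<eta>)"
    using True D_pos \<eta>_pos by (intro mult_right_mono) auto
  also have "\<dots> = L * \<eta> / 2 + L * D / 2"
    using \<eta>_pos by (simp add: field_simps)
  also have "\<dots> \<le> L * \<eta> + L * D / 2"
    using L_pos \<eta>_pos by simp
  finally show ?thesis
    using gap_le [of "Suc k"] \<eta>_pos divide_right_mono [of "\<Phi> (Suc k)" M \<eta>] by simp
next
  case False
  define s where "s = S k"
  define \<delta> where "\<delta> = S (Suc k) - S k"
  have s: "s > 0" "\<delta> \<ge> 0"
    using S_pos [OF assms(1)] S_mono_step [OF assms(1)] by (auto simp: s_def \<delta>_def)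
  have "\<delta> \<le> s * (D / \<eta>)"
    using S_step_le [OF assms(1)] by (simp add: s_def \<delta>_def algebra_simps)
  \<comment> \<open>The left-hand side is the part of \<delta> not compensated by
    \<open>gap_decrease\<close>. The bound on \<delta> cancels the denominator \<open>s\<close>, and
    \<open>s > L * \<eta> / 2\<close> then halves the constant.\<close>
  then have "\<delta> * ((L * \<eta> - s) / s) \<le> s * (D / \<eta>) * ((L * \<eta> - s) / s)"
    using s assms(2) by (intro mult_right_mono) (auto simp: s_def)
  also have "\<dots> = (L * \<eta> - s) * (D / \<eta>)"
    using s(1) by simp
  also have "\<dots> \<le> (L * \<eta> / 2) * (D / \<eta>)"
    using False D_pos \<eta>_pos by (intro mult_right_mono) (auto simp: s_def)
  also have "\<dots> = L * D / 2"
    using \<eta>_pos by simp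
  finally have "\<delta> * ((L * \<eta> - s) / s) \<le> L * D / 2" .
  moreover have "\<delta> - 2 * \<delta> * (1 - L * \<eta> / 2 / s) = \<delta> * ((L * \<eta> - s) / s)"
    using s(1) by (simp add: field_simps)
  moreover have "S (Suc k) = s + \<delta>" "s \<le> L * \<eta>"
    using assms(2) by (auto simp: s_def \<delta>_def)
  ultimately have \<delta>: "S (Suc k) \<le> L * \<eta> + L * D / 2 + 2 * \<delta> * (1 - L * \<eta> / 2 / s)"
    by linarith
  \<comment> \<open>The term subtracted here is the one added in the bound for
    \<open>S (Suc k)\<close>, so it vanishes from the potential.\<close>
  have "\<Phi> (Suc k) / \<eta> \<le> (M - \<eta> * (2 * \<delta> * (1 - L * \<eta> / 2 / s))) / \<eta>"
    using gap_decrease [OF assms(1)] False gap_le [OF assms(1)] \<eta>_pos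
    by (intro divide_right_mono) (auto simp: s_def \<delta>_def)
  also have "\<dots> = M / \<eta> - 2 * \<delta> * (1 - L * \<eta> / 2 / s)"
    using \<eta>_pos by (simp add: diff_divide_distrib)
  finally show ?thesis
    using \<delta> by linarith
qed

text \<open>If \<gamma> already reaches \<open>L * \<eta>\<close>, the potential decreases from the
  start and \<open>S k \<le> \<gamma> + M / \<eta>\<close>; the cross term of its square is
  \<open>2 * M * \<gamma> / \<eta>\<close>. Otherwise the crossing bound alone controls
  \<open>S\<close>.\<close>

lemma S_power2_le:
  assumes "k \<ge> 1"
  shows "(S k)\<^sup>2 - \<gamma>\<^sup>2 \<le> (M / \<eta> + L * \<eta> + L * D / 2)\<^sup>2 + 2 * M * \<gamma> / \<eta>"
proof -
  let ?B = "M / \<eta> + L * \<eta> + L * D / 2"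
  have "M \<ge> 0"
    using gap_le [of 1] \<Phi>_nonneg [of 1] by simp
  have pos: "M / \<eta> \<ge> 0" "L * \<eta> > 0" "L * D / 2 > 0" "2 * M * \<gamma> / \<eta> \<ge> 0"
    using L_pos D_pos \<eta>_pos \<gamma>_pos \<open>M \<ge> 0\<close> by auto
  show ?thesis
  proof (cases "L * \<eta> \<le> \<gamma>")
    case True
    have "L * \<eta> \<le> S k \<and> S k + \<Phi> k / \<eta> \<le> \<gamma> + M / \<eta>"
      using assms
    proof (induction k rule: nat_induct_at_least)
      case base
      show ?case
        using True gap_le [of 1] \<eta>_pos by (simp add: S_1 [simplified] divide_right_mono)
    next
      case (Suc k)
      then show ?case
        using S_mono_step [of k] potential_decreasing [of k] by auto
    qed
    then have "S k \<le> \<gamma> + M / \<eta>"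
      using \<Phi>_nonneg [OF assms] \<eta>_pos by (smt (verit) divide_nonneg_pos)
    then have "(S k)\<^sup>2 \<le> (\<gamma> + M / \<eta>)\<^sup>2"
      using S_pos [OF assms] by (intro power_mono) auto
    moreover have "(M / \<eta>)\<^sup>2 \<le> ?B\<^sup>2"
      using pos by (intro power_mono) auto
    moreover have "(\<gamma> + M / \<eta>)\<^sup>2 = \<gamma>\<^sup>2 + (M / \<eta>)\<^sup>2 + 2 * M * \<gamma> / \<eta>"
      by (simp add: power2_sum)
    ultimately show ?thesis
      by linarith
  next
    case False
    \<comment> \<open>A disjunction is preserved: from the first alternative
      \<open>potential_after_crossing\<close> leads to the second, and above the threshold
      \<open>potential_decreasing\<close> maintains the second.\<close>
    have "S k \<le> L * \<eta> \<or> S k + \<Phi> k / \<eta> \<le> ?B"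
      using assms
    proof (induction k rule: nat_induct_at_least)
      case base
      show ?case
        using False by (simp add: S_1 [simplified])
    next
      case (Suc k)
      then show ?case
        using potential_after_crossing [of k] potential_decreasing [of k]
        by (cases "S k \<le> L * \<eta>") auto
    qed
    then have "S k \<le> ?B"
      using pos \<Phi>_nonneg [OF assms] \<eta>_pos by (smt (verit) divide_nonneg_pos)
    then have "(S k)\<^sup>2 \<le> ?B\<^sup>2"
      using S_pos [OF assms] by (intro power_mono) auto
    with pos(4) show ?thesis
      by (smt (verit) zero_le_power2)
  qed
qed

end

section \<open>From the proximal iterates to the scalar recursion\<close>

theorem theorem1:
  fixes f :: "real ^ 'd \<Rightarrow> real"
    and h F :: "real ^ 'd \<Rightarrow> ereal"
    and Fstar :: ereal
    and x :: "nat \<Rightarrow> real ^ 'd"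
    and S :: "nat \<Rightarrow> real"
    and L \<gamma> \<eta> D M :: real
    and t :: nat
  assumes "L > 0" and "smooth_with L f"
    and "ereal_proper h" and "ereal_convex h" and "ereal_lsc h"
    and F: "F = (\<lambda>z. ereal (f z) + h z)"
    and bounded_below: "\<exists>b::real. \<forall>z. ereal b \<le> F z"
    and Fstar: "Fstar = (INF z. F z)"
    and "\<gamma> > 0" and "\<eta> > 0"
    and x1: "x 1 \<in> effective_domain h"
    and iterates: "\<forall>k\<ge>1. x (k + 1) =
          arg_min (\<lambda>z. ereal (gradient f (x k) \<bullet> z + S k / (2 * \<eta>) * (norm (z - x k))\<^sup>2) + h z)
                  (\<lambda>_. True)"
    and S1: "S 1 = \<gamma>"
    and S_pos: "\<forall>k\<ge>1. S k > 0"
    and S_step: "\<forall>k\<ge>1. (S (k + 1))\<^sup>2 = (S k)\<^sup>2 * (1 + (norm (x (k + 1) - x k))\<^sup>2 / \<eta>\<^sup>2)"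
    and "D > 0"
    and steps_bounded: "\<forall>k\<ge>1. norm (x (k + 1) - x k) \<le> D"
    and convex_case: "ereal_convex F \<longrightarrow>
          (\<exists>xstar. (\<forall>z. F xstar \<le> F z) \<and> (\<forall>k\<ge>1. norm (x k - xstar) \<le> D))"
    and M: "M = real_of_ereal (F (x 1) - Fstar)
                + max 0 (L * (\<eta>\<^sup>2 + D\<^sup>2) * ln (L * \<eta> / (2 * \<gamma>)) + L * D\<^sup>2 / 2)"
    and "t \<ge> 1"
  shows "(1 / real t) * (\<Sum>k=1..t. (norm (gradient_mapping f h (\<eta> / S k) (x k)))\<^sup>2)
         \<le> (1 / real t) * ((M / \<eta> + L * \<eta> + L * D / 2)\<^sup>2 + 2 * M * \<gamma> / \<eta>)"
proof -
  have ninf: "h z \<noteq> -\<infinity>" for z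
    using \<open>ereal_proper h\<close> by (simp add: ereal_proper_def)
  define \<phi> where "\<phi> k = (\<lambda>z. ereal (gradient f (x k) \<bullet> z + S k / (2 * \<eta>) * (norm (z - x k))\<^sup>2) + h z)"
    for k
  have coeff_pos: "S k / (2 * \<eta>) > 0" if "k \<ge> 1" for k
    using that S_pos \<open>\<eta> > 0\<close> by simp
  have minimizer: "\<phi> k (x (Suc k)) \<le> \<phi> k z" if k: "k \<ge> 1" "x k \<in> effective_domain h" for k z
  proof -
    have "\<exists>p. \<forall>z. \<phi> k p \<le> \<phi> k z"
      unfolding \<phi>_def using assms coeff_pos k by (intro prox_model_minimizer_exists) auto
    \<comment> \<open>The value of \<open>arg_min\<close> is unspecified unless a minimizer exists,
      so existence must precede any use of the iterates.\<close>
    then have "\<exists>p. is_arg_min (\<phi> k) (\<lambda>_. True) p"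
      by (auto simp: is_arg_min_def not_less)
    then have "is_arg_min (\<phi> k) (\<lambda>_. True) (arg_min (\<phi> k) (\<lambda>_. True))"
      unfolding arg_min_def by (rule someI_ex)
    moreover have "x (Suc k) = arg_min (\<phi> k) (\<lambda>_. True)"
      using iterates k(1) by (simp add: \<phi>_def)
    ultimately show ?thesis
      by (auto simp: is_arg_min_def not_less)
  qed
  have dom: "x k \<in> effective_domain h" if "k \<ge> 1" for k
    using that
  proof (induction k rule: nat_induct_at_least)
    case (Suc k)
    have "\<phi> k (x (Suc k)) \<le> \<phi> k (x k)"
      using minimizer Suc by blast
    also have "\<dots> < \<infinity>"
      using Suc.IH by (simp add: \<phi>_def effective_domain_def)
    finally show ?case
      using ninf by (simp add: \<phi>_def effective_domain_def)
  qed (use x1 in simp)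
  define H where "H k = real_of_ereal (h (x k))" for k
  have H: "h (x k) = ereal (H k)" if "k \<ge> 1" for k
    using dom [OF that] ninf [of "x k"] by (cases "h (x k)") (auto simp: H_def effective_domain_def)
  have Fx: "F (x k) = ereal (f (x k) + H k)" if "k \<ge> 1" for k
    using H [OF that] by (simp add: F)
  obtain b where b: "\<And>z. ereal b \<le> F z"
    using bounded_below by blast
  have Fstar_le: "Fstar \<le> F z" for z
    unfolding Fstar by (rule INF_lower) simp
  have "ereal b \<le> Fstar"
    unfolding Fstar using b by (intro INF_greatest) auto
  then obtain m where m: "Fstar = ereal m"
    using Fstar_le [of "x 1"] Fx [of 1] by (cases Fstar) auto
  define \<Phi> where "\<Phi> k = f (x k) + H k - m" for k
  interpret adaptive_descent \<Phi> S "\<lambda>k. norm (x (Suc k) - x k)" L \<gamma> \<eta> D M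
  proof
    fix k :: nat assume k: "k \<ge> 1"
    show "\<Phi> k \<ge> 0"
      using Fstar_le [of "x k"] k by (simp add: \<Phi>_def m Fx)
    show "S k > 0" "norm (x (Suc k) - x k) \<le> D"
        "(S (Suc k))\<^sup>2 = (S k)\<^sup>2 * (1 + (norm (x (Suc k) - x k))\<^sup>2 / \<eta>\<^sup>2)"
      using k S_pos S_step steps_bounded by auto
    let ?d = "norm (x (Suc k) - x k)"
    let ?g = "gradient f (x k)"
    \<comment> \<open>The comparison point is \<open>x k\<close>. The growth term equals the
      quadratic penalty of the step, so together they yield \<open>S k / \<eta>\<close>, twice the
      model coefficient.\<close>
    have "?g \<bullet> x (Suc k) + S k / (2 * \<eta>) * ?d\<^sup>2 + H (Suc k)
          + S k / (2 * \<eta>) * (norm (x k - x (Suc k)))\<^sup>2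
        \<le> ?g \<bullet> x k + S k / (2 * \<eta>) * (norm (x k - x k))\<^sup>2 + H k"
      using minimizer [OF k dom [OF k]] H k \<open>ereal_convex h\<close>
      by (intro prox_model_strong_minimum [where h = h]) (auto simp: \<phi>_def)
    then have "?g \<bullet> (x (Suc k) - x k) + S k / \<eta> * ?d\<^sup>2 + H (Suc k) \<le> H k"
      by (simp add: norm_minus_commute inner_diff_right)
    moreover have "f (x (Suc k)) \<le> f (x k) + ?g \<bullet> (x (Suc k) - x k) + L / 2 * ?d\<^sup>2"
      by (rule smooth_with_upper_bound [OF \<open>smooth_with L f\<close>])
    ultimately show "\<Phi> (Suc k) \<le> \<Phi> k + (L / 2 - S k / \<eta>) * ?d\<^sup>2"
      by (simp add: \<Phi>_def left_diff_distrib)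
  next
    show "M = \<Phi> 1 + max 0 (L * (\<eta>\<^sup>2 + D\<^sup>2) * ln (L * \<eta> / (2 * \<gamma>)) + L * D\<^sup>2 / 2)"
      by (simp add: M Fx m \<Phi>_def)
  qed (use assms in auto)
  \<comment> \<open>The squared gradient mapping is \<open>(S k / \<eta>)\<^sup>2\<close> times the
    squared step, which is exactly the increment prescribed by the recursion for \<open>S\<close>;
    hence the sum telescopes.\<close>
  have G: "(norm (gradient_mapping f h (\<eta> / S k) (x k)))\<^sup>2 = (S (Suc k))\<^sup>2 - (S k)\<^sup>2"
    if k: "k \<ge> 1" for k
  proof -
    have "S k > 0"
      using S_pos k by blast
    then have "prox (\<lambda>z. ereal (\<eta> / S k) * h z) (x k - (\<eta> / S k) *\<^sub>R gradient f (x k)) = x (Suc k)"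
      using prox_forward_step [of "\<eta> / S k" h "x k"] ninf \<open>\<eta> > 0\<close> iterates k
      by (simp add: divide_simps mult.commute)
    then have "(norm (gradient_mapping f h (\<eta> / S k) (x k)))\<^sup>2
        = (S k / \<eta>)\<^sup>2 * (norm (x (Suc k) - x k))\<^sup>2"
      by (simp add: gradient_mapping_def norm_minus_commute power_mult_distrib power_divide)
    then show ?thesis
      using S_step k by (simp add: power_divide distrib_left)
  qed
  have "(\<Sum>k=1..t. (norm (gradient_mapping f h (\<eta> / S k) (x k)))\<^sup>2)
      = (\<Sum>k=1..t. (S (Suc k))\<^sup>2 - (S k)\<^sup>2)"
    by (rule sum.cong [OF refl], rule G) simp
  also have "\<dots> = (S (Suc t))\<^sup>2 - \<gamma>\<^sup>2"
    using sum_Suc_diff [of 1 t "\<lambda>k. (S k)\<^sup>2"] S1 by simp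
  also have "\<dots> \<le> (M / \<eta> + L * \<eta> + L * D / 2)\<^sup>2 + 2 * M * \<gamma> / \<eta>"
    by (rule S_power2_le) simp
  finally show ?thesis
    by (intro mult_left_mono) auto
qed

end
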